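(* Let $\kappa$ be an uncountable regular cardinal such that $\diamond(\kappa)$ holds. Then there is a $\kappa$-complete filter $\mathcal{F}$ over $\kappa$ with $Cub_\kappa\subseteq\mathcal{F}$ which fails the Galvin property, i.e., there is a sequence $\langle A_i\mid i<\kappa^+\rangle$ of members of $\mathcal{F}$ such that $\bigcap_{i\in I}A_i\notin\mathcal{F}$ for every $I\in[\kappa^+]^\kappa$.
   Context: $Cub_\kappa$ is the club filter on $\kappa$. $\diamond(\kappa)$ asserts that there is a sequence $\langle X_\alpha\mid\alpha<\kappa\rangle$ with $X_\alpha\subseteq\alpha$ such that for every $X\subseteq\kappa$ the set $\{\alpha<\kappa\mid X\cap\alpha=X_\alpha\}$ is stationary. *)

theory Defs
  imports Main
begin

unbundle cardinal_syntax

text \<open>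
  A cardinal \<open>\<kappa>\<close> is a cardinal order \<open>r\<close> in the sense of HOL's BNF cardinals.  The ordinals
  below \<open>\<kappa>\<close> are the elements of \<open>Field r\<close>, and such an ordinal \<open>\<alpha>\<close>, regarded as the set of its
  predecessors, is \<open>underS r \<alpha>\<close>.
\<close>

text \<open>
  Since the witness \<open>\<gamma>\<close> lies strictly between \<open>\<beta>\<close> and \<open>\<delta>\<close>, the hypothesis of closedness fails at
  successors \<open>\<delta>\<close>; together with \<open>underS r \<delta> \<noteq> {}\<close>, which excludes the least element, it says that
  \<open>\<delta>\<close> is a limit ordinal in which \<open>C \<inter> \<delta>\<close> is unbounded.
\<close>

definition closed_in_card :: "'a rel \<Rightarrow> 'a set \<Rightarrow> bool" where
  "closed_in_card r C \<longleftrightarrow>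
     (\<forall>\<delta>\<in>Field r. underS r \<delta> \<noteq> {} \<and> (\<forall>\<beta>\<in>underS r \<delta>. \<exists>\<gamma>\<in>C \<inter> underS r \<delta>. \<beta> \<in> underS r \<gamma>) \<longrightarrow> \<delta> \<in> C)"

definition club :: "'a rel \<Rightarrow> 'a set \<Rightarrow> bool" where
  "club r C \<longleftrightarrow> C \<subseteq> Field r \<and> cofinal C r \<and> closed_in_card r C"

definition stationary :: "'a rel \<Rightarrow> 'a set \<Rightarrow> bool" where
  "stationary r S \<longleftrightarrow> S \<subseteq> Field r \<and> (\<forall>C. club r C \<longrightarrow> S \<inter> C \<noteq> {})"

definition Cub :: "'a rel \<Rightarrow> 'a set set" where
  "Cub r = {A. A \<subseteq> Field r \<and> (\<exists>C. club r C \<and> C \<subseteq> A)}"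

definition diamond :: "'a rel \<Rightarrow> bool" where
  "diamond r \<longleftrightarrow>
     (\<exists>X :: 'a \<Rightarrow> 'a set.
        (\<forall>\<alpha>\<in>Field r. X \<alpha> \<subseteq> underS r \<alpha>) \<and>
        (\<forall>Y. Y \<subseteq> Field r \<longrightarrow> stationary r {\<alpha> \<in> Field r. Y \<inter> underS r \<alpha> = X \<alpha>}))"

text \<open>
  Filters are proper.  They are families of subsets of a set \<open>S\<close>, rather than elements of the
  library's \<^typ>\<open>'a filter\<close>, whose underlying set is always the whole type and which may be improper.
\<close>

definition filter_over :: "'a set \<Rightarrow> 'a set set \<Rightarrow> bool" where
  "filter_over S F \<longleftrightarrow>
     F \<subseteq> Pow S \<and> S \<in> F \<and> {} \<notin> F \<and>
     (\<forall>A\<in>F. \<forall>B\<in>F. A \<inter> B \<in> F) \<and>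
     (\<forall>A\<in>F. \<forall>B. A \<subseteq> B \<and> B \<subseteq> S \<longrightarrow> B \<in> F)"

definition card_complete :: "'a rel \<Rightarrow> 'a set set \<Rightarrow> bool" where
  "card_complete r F \<longleftrightarrow> (\<forall>G. G \<subseteq> F \<and> G \<noteq> {} \<and> |G| <o r \<longrightarrow> \<Inter>G \<in> F)"

end

theory Submission
  imports Defs
begin

text \<open>
  A set \<open>X \<subseteq> \<kappa>\<close> codes, through a pairing function, a \<open>\<kappa>\<close>-sequence of subsets of \<open>\<kappa>\<close>.  Given a
  diamond sequence \<open>X\<^sub>\<alpha>\<close>, let \<open>S\<^sub>\<alpha>\<close> consist of the subsets of \<open>\<alpha>\<close> coded by \<open>X\<^sub>\<alpha>\<close> with an index below
  \<open>\<alpha>\<close>, except the one coded at a distinguished index \<open>z\<close>, and for \<open>Y \<subseteq> \<kappa>\<close> let \<open>A\<^sub>Y\<close> be the set of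
  \<open>\<alpha>\<close> with \<open>Y \<inter> \<alpha> \<in> S\<^sub>\<alpha>\<close>.  If \<open>J\<close> is a family of fewer than \<open>\<kappa>\<close> subsets of \<open>\<kappa>\<close> and \<open>Z \<notin> J\<close>, guessing
  a set that codes \<open>Z\<close> at \<open>z\<close> and the members of \<open>J\<close> at other indices shows that
  \<open>\<Inter>\<^sub>Y\<^sub>\<in>\<^sub>J A\<^sub>Y - A\<^sub>Z\<close> is stationary.  Hence the \<open>\<kappa>\<close>-complete filter generated by the clubs and
  the sets \<open>A\<^sub>Y\<close> is proper, and none of its members is contained in \<open>\<kappa>\<close> many of the \<open>A\<^sub>Y\<close>; there are
  \<open>2\<^sup>\<kappa> \<ge> \<kappa>\<^sup>+\<close> of these.
\<close>

section \<open>Ordinals below an uncountable regular cardinal\<close>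

locale uncountable_regular_card =
  fixes r :: "'a rel"
  assumes Card: "Card_order r"
    and uncountable: "natLeq <o r"
    and regular: "regularCard r"
begin

lemma wo_rel: "wo_rel r"
  using Card by (simp add: card_order_on_well_order_on wo_rel_def)

lemma underS_trans: "a \<in> underS r b \<Longrightarrow> b \<in> underS r c \<Longrightarrow> a \<in> underS r c"
  using wo_rel.TRANS[OF wo_rel] wo_rel.ANTISYM[OF wo_rel]
  unfolding underS_def trans_def antisym_def by blast

lemma underS_linear:
  "a \<in> Field r \<Longrightarrow> b \<in> Field r \<Longrightarrow> a \<noteq> b \<Longrightarrow> a \<in> underS r b \<or> b \<in> underS r a"
  using wo_rel.TOTALS[OF wo_rel] unfolding underS_def by blast

lemma underS_in_Field: "a \<in> underS r b \<Longrightarrow> a \<in> Field r \<and> b \<in> Field r"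
  unfolding underS_def Field_def by blast

lemma cinfinite: "cinfinite r"
  using cinfinite_mono[OF ordLess_imp_ordLeq[OF uncountable] natLeq_cinfinite] .

lemma infinite_Field: "infinite (Field r)"
  using cinfinite by (simp add: cinfinite_def)

lemma stable: "stable r"
  using regularCard_stable[OF Card infinite_Field regular] .

lemma finite_less: "finite A \<Longrightarrow> |A| <o r"
  using finite_ordLess_infinite[OF card_of_Well_order wo_rel.WELL[OF wo_rel]] infinite_Field
  by (simp add: Field_card_of)

lemma range_nat_less: "|range (f :: nat \<Rightarrow> 'b)| <o r"
proof -
  have "|range f| \<le>o |UNIV :: nat set|"
    by (rule card_of_image)
  also have "|UNIV :: nat set| =o natLeq"
    by (rule card_of_nat)
  finally show ?thesis
    using uncountable ordLeq_ordLess_trans by blast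
qed

lemma Un_less: "|A| <o r \<Longrightarrow> |B| <o r \<Longrightarrow> |A \<union> B| <o r"
  using card_of_Un_ordLess_infinite_Field[OF infinite_Field Card] .

lemma image_less: "|A| <o r \<Longrightarrow> |f ` A| <o r"
  using card_of_image ordLeq_ordLess_trans by blast

lemma UN_less: "|A| <o r \<Longrightarrow> (\<And>a. a \<in> A \<Longrightarrow> |f a| <o r) \<Longrightarrow> |\<Union>a\<in>A. f a| <o r"
  using stable_UNION[OF stable] by blast

text \<open>By regularity a cofinal set has cardinality \<kappa>, so a smaller \<open>K\<close> has
  a weak upper bound; as \<kappa> is a limit ordinal, some element lies strictly above that
  bound.\<close>

lemma less_bounded:
  assumes "K \<subseteq> Field r" "|K| <o r"
  shows "\<exists>b\<in>Field r. K \<subseteq> underS r b"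
proof -
  have "\<not> cofinal K r"
    using assms regular not_ordLess_ordIso unfolding regularCard_def by blast
  then obtain a where a: "a \<in> Field r" "\<forall>k\<in>K. a \<notin> underS r k"
    unfolding cofinal_def underS_def by blast
  obtain b where b: "b \<in> Field r" "a \<in> underS r b"
    using infinite_Card_order_limit[OF Card infinite_Field a(1)] unfolding underS_def by blast
  have "K \<subseteq> underS r b"
  proof
    fix k assume "k \<in> K"
    then show "k \<in> underS r b"
      using a b assms(1) underS_linear[of a k] underS_trans[of k a b] by blast
  qed
  then show ?thesis using b(1) by blast
qed

lemma underS_least:
  assumes "S \<subseteq> Field r" "S \<noteq> {}"
  obtains m where "m \<in> S" "\<And>s. s \<in> S \<Longrightarrow> s \<notin> underS r m"
proof
  show "wo_rel.minim r S \<in> S"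
    using wo_rel.minim_in[OF wo_rel assms] .
  show "s \<notin> underS r (wo_rel.minim r S)" if "s \<in> S" for s
    using wo_rel.minim_least[OF wo_rel assms(1) that] wo_rel.ANTISYM[OF wo_rel]
    unfolding underS_def antisym_def by blast
qed

section \<open>Clubs: closure points and intersections\<close>

lemma club_closure_points:
  assumes D: "\<And>\<beta>. \<beta> \<in> Field r \<Longrightarrow> D \<beta> \<in> Field r"
  shows "club r {\<delta>\<in>Field r. underS r \<delta> \<noteq> {} \<and> (\<forall>\<beta>\<in>underS r \<delta>. D \<beta> \<in> underS r \<delta>)}" (is "club r ?E")
proof -
  have "\<exists>\<delta>\<in>?E. \<beta>0 \<in> underS r \<delta>" if \<beta>0: "\<beta>0 \<in> Field r" for \<beta>0
  proof -
    \<comment> \<open>As \<open>D\<close> may fail to be monotone, a single step upwards has to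
      dominate \<open>D\<close> on the whole initial segment up to \<open>x\<close>.\<close>
    have "\<forall>x\<in>Field r. \<exists>y\<in>Field r. insert x (underS r x) \<union> D ` insert x (underS r x) \<subseteq> underS r y"
    proof
      fix x assume x: "x \<in> Field r"
      let ?U = "insert x (underS r x)"
      have "|?U| <o r"
        using Un_less[of "{x}" "underS r x"] finite_less[of "{x}"] card_of_underS[OF Card x] by simp
      then have "|?U \<union> D ` ?U| <o r"
        using Un_less image_less by blast
      moreover have "?U \<union> D ` ?U \<subseteq> Field r"
        using x D underS_in_Field by blast
      ultimately show "\<exists>y\<in>Field r. ?U \<union> D ` ?U \<subseteq> underS r y"
        using less_bounded by blast
    qed
    then obtain g where g: "\<And>x. x \<in> Field r \<Longrightarrow> g x \<in> Field r"
      "\<And>x. x \<in> Field r \<Longrightarrow> insert x (underS r x) \<union> D ` insert x (underS r x) \<subseteq> underS r (g x)"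
      by metis
    define s where "s n = (g ^^ n) \<beta>0" for n
    have sF: "s n \<in> Field r" for n
      by (induction n) (auto simp: s_def \<beta>0 g(1))
    have s_Suc: "s (Suc n) = g (s n)" for n
      by (simp add: s_def)
    \<comment> \<open>The \<omega>-sequence \<open>s\<close> is bounded because \<kappa> is
      uncountable and regular. Its least strict upper bound is the desired closure point: anything
      below it is at most some \<open>s n\<close>, so \<open>D\<close> sends it below
      \<open>s (Suc n)\<close>.\<close>
    let ?B = "{b\<in>Field r. range s \<subseteq> underS r b}"
    have "?B \<noteq> {}"
      using less_bounded[OF _ range_nat_less[of s]] sF by blast
    then obtain \<delta> where \<delta>: "\<delta> \<in> ?B" and least: "\<And>b. b \<in> ?B \<Longrightarrow> b \<notin> underS r \<delta>"
      using underS_least[of ?B] by blast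
    have "D \<beta> \<in> underS r \<delta>" if \<beta>: "\<beta> \<in> underS r \<delta>" for \<beta>
    proof -
      have "\<beta> \<notin> ?B"
        using least \<beta> by blast
      then obtain n where "s n \<notin> underS r \<beta>"
        using \<beta> underS_in_Field by blast
      then have "\<beta> \<in> insert (s n) (underS r (s n))"
        using underS_linear[of \<beta> "s n"] sF \<beta> underS_in_Field by blast
      then have "D \<beta> \<in> underS r (s (Suc n))"
        using g(2)[OF sF] unfolding s_Suc by blast
      moreover have "s (Suc n) \<in> underS r \<delta>"
        using \<delta> by blast
      ultimately show ?thesis
        using underS_trans by blast
    qed
    moreover have "\<beta>0 \<in> underS r \<delta>"
    proof -
      have "s 0 \<in> underS r \<delta>"
        using \<delta> by blast
      then show ?thesis by (simp add: s_def)
    qed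
    ultimately show ?thesis
      using \<delta> by blast
  qed
  then have "cofinal ?E r"
    unfolding cofinal_def underS_def by blast
  moreover have "closed_in_card r ?E"
    unfolding closed_in_card_def
  proof (intro ballI impI)
    fix \<delta>
    assume \<delta>: "\<delta> \<in> Field r"
      and lim: "underS r \<delta> \<noteq> {} \<and> (\<forall>\<beta>\<in>underS r \<delta>. \<exists>\<gamma>\<in>?E \<inter> underS r \<delta>. \<beta> \<in> underS r \<gamma>)"
    have "D \<beta> \<in> underS r \<delta>" if "\<beta> \<in> underS r \<delta>" for \<beta>
      using lim that underS_trans by blast
    then show "\<delta> \<in> ?E"
      using \<delta> lim by blast
  qed
  ultimately show ?thesis
    unfolding club_def by blast
qed

text \<open>Closedness passes to intersections directly. For unboundedness, let \<open>D x\<close>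
  bound elements of all the \<open>C i\<close> chosen above \<open>x\<close>; every closure point of
  \<open>D\<close> is then a limit of each \<open>C i\<close>, and the closure points are already
  cofinal.\<close>

lemma club_Inter:
  assumes "|I| <o r" "I \<noteq> {}" and club: "\<And>i. i \<in> I \<Longrightarrow> club r (C i)"
  shows "club r (\<Inter>i\<in>I. C i)"
proof -
  have sub: "C i \<subseteq> Field r" if "i \<in> I" for i
    using club[OF that] by (simp add: club_def)
  have "\<exists>y. i \<in> I \<longrightarrow> x \<in> Field r \<longrightarrow> y \<in> C i \<and> x \<in> underS r y" for i x
    using club[of i] unfolding club_def cofinal_def underS_def by blast
  then obtain c where c: "\<And>i x. i \<in> I \<Longrightarrow> x \<in> Field r \<Longrightarrow> c i x \<in> C i \<and> x \<in> underS r (c i x)"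
    by metis
  have "\<exists>d. x \<in> Field r \<longrightarrow> d \<in> Field r \<and> (\<lambda>i. c i x) ` I \<subseteq> underS r d" for x
    using less_bounded[OF _ image_less[OF assms(1)], of "\<lambda>i. c i x"] c sub by blast
  then obtain D where D: "\<And>x. x \<in> Field r \<Longrightarrow> D x \<in> Field r"
    "\<And>x. x \<in> Field r \<Longrightarrow> (\<lambda>i. c i x) ` I \<subseteq> underS r (D x)"
    by metis
  let ?E = "{\<delta>\<in>Field r. underS r \<delta> \<noteq> {} \<and> (\<forall>\<beta>\<in>underS r \<delta>. D \<beta> \<in> underS r \<delta>)}"
  have "\<delta> \<in> C i" if \<delta>: "\<delta> \<in> ?E" and i: "i \<in> I" for \<delta> i
  proof -
    have "\<exists>\<gamma>\<in>C i \<inter> underS r \<delta>. \<beta> \<in> underS r \<gamma>" if \<beta>: "\<beta> \<in> underS r \<delta>" for \<beta>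
    proof -
      have F: "\<beta> \<in> Field r"
        using \<beta> underS_in_Field by blast
      have "c i \<beta> \<in> underS r (D \<beta>)"
        using D(2)[OF F] i by blast
      then have "c i \<beta> \<in> underS r \<delta>"
        using \<delta> \<beta> underS_trans by blast
      then show ?thesis
        using c[OF i F] by blast
    qed
    then show ?thesis
      using club[OF i] \<delta> unfolding club_def closed_in_card_def by blast
  qed
  then have "?E \<subseteq> (\<Inter>i\<in>I. C i)"
    by blast
  then have "cofinal (\<Inter>i\<in>I. C i) r"
    using club_closure_points[of D] D(1) unfolding club_def cofinal_def by (meson subsetD)
  moreover have "closed_in_card r (\<Inter>i\<in>I. C i)"
    unfolding closed_in_card_def
  proof (intro ballI impI INT_I)
    fix \<delta> i
    assume "\<delta> \<in> Field r" "i \<in> I"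
      "underS r \<delta> \<noteq> {} \<and> (\<forall>\<beta>\<in>underS r \<delta>. \<exists>\<gamma>\<in>(\<Inter>i\<in>I. C i) \<inter> underS r \<delta>. \<beta> \<in> underS r \<gamma>)"
    then show "\<delta> \<in> C i"
      using club[of i] unfolding club_def closed_in_card_def by blast
  qed
  moreover have "(\<Inter>i\<in>I. C i) \<subseteq> Field r"
    using sub assms(2) by blast
  ultimately show ?thesis
    unfolding club_def by blast
qed

lemma club_Int:
  assumes "club r C" "club r C'"
  shows "club r (C \<inter> C')"
proof -
  have "club r (\<Inter>B\<in>{C, C'}. B)"
    by (rule club_Inter) (auto simp: assms finite_less)
  then show ?thesis by simp
qed

lemma club_Field: "club r (Field r)"
  using infinite_Card_order_limit[OF Card infinite_Field]
  unfolding club_def closed_in_card_def cofinal_def by blast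

text \<open>Again closure points suffice: \<open>D x\<close> bounds the values of \<open>p\<close>
  on pairs up to \<open>x\<close> and, regardless of \<open>x\<close>, also
  \<open>B\<close>.\<close>

lemma club_above_closed:
  assumes "B \<subseteq> Field r" "|B| <o r"
    and p: "\<And>x y. x \<in> Field r \<Longrightarrow> y \<in> Field r \<Longrightarrow> p x y \<in> Field r"
  obtains E where "club r E" "\<And>\<delta>. \<delta> \<in> E \<Longrightarrow> B \<subseteq> underS r \<delta>"
    "\<And>\<delta> x y. \<delta> \<in> E \<Longrightarrow> x \<in> underS r \<delta> \<Longrightarrow> y \<in> underS r \<delta> \<Longrightarrow> p x y \<in> underS r \<delta>"
proof -
  define U where "U x = insert x (underS r x)" for x
  have U: "|U x| <o r" "U x \<subseteq> Field r" if "x \<in> Field r" for x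
    using that Un_less[of "{x}" "underS r x"] finite_less[of "{x}"] card_of_underS[OF Card that]
      underS_in_Field unfolding U_def by auto
  have "\<exists>d. x \<in> Field r \<longrightarrow> d \<in> Field r \<and> (\<Union>u\<in>U x. p u ` U x) \<union> B \<subseteq> underS r d" for x
  proof (cases "x \<in> Field r")
    case True
    have "|(\<Union>u\<in>U x. p u ` U x) \<union> B| <o r"
      by (intro Un_less UN_less image_less U(1)[OF True] assms(2))
    moreover have "(\<Union>u\<in>U x. p u ` U x) \<union> B \<subseteq> Field r"
      using U(2)[OF True] p assms(1) by blast
    ultimately show ?thesis
      using less_bounded by blast
  qed blast
  then obtain D where D: "\<And>x. x \<in> Field r \<Longrightarrow> D x \<in> Field r"
    "\<And>x. x \<in> Field r \<Longrightarrow> (\<Union>u\<in>U x. p u ` U x) \<union> B \<subseteq> underS r (D x)"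
    by metis
  let ?E = "{\<delta>\<in>Field r. underS r \<delta> \<noteq> {} \<and> (\<forall>\<beta>\<in>underS r \<delta>. D \<beta> \<in> underS r \<delta>)}"
  have below: "(\<Union>u\<in>U x. p u ` U x) \<union> B \<subseteq> underS r \<delta>" if "\<delta> \<in> ?E" "x \<in> underS r \<delta>" for \<delta> x
  proof -
    have "(\<Union>u\<in>U x. p u ` U x) \<union> B \<subseteq> underS r (D x)" "D x \<in> underS r \<delta>"
      using D(2) that underS_in_Field by blast+
    then show ?thesis
      using underS_trans by (meson subset_iff)
  qed
  show ?thesis
  proof
    show "club r ?E"
      using club_closure_points D(1) by blast
    \<comment> \<open>A closure point is not the least element, so it has a predecessor to which
      \<open>below\<close> applies.\<close>
    show "B \<subseteq> underS r \<delta>" if "\<delta> \<in> ?E" for \<delta>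
      using below[OF that] that by blast
    show "p x y \<in> underS r \<delta>" if \<delta>: "\<delta> \<in> ?E" and xy: "x \<in> underS r \<delta>" "y \<in> underS r \<delta>" for \<delta> x y
    proof -
      \<comment> \<open>The larger of \<open>x\<close> and \<open>y\<close> serves as
        \<open>m\<close>.\<close>
      have "x = y \<or> x \<in> underS r y \<or> y \<in> underS r x"
        using underS_linear[of x y] xy underS_in_Field by blast
      then obtain m where "m \<in> underS r \<delta>" "x \<in> U m" "y \<in> U m"
        using xy unfolding U_def by blast
      then show ?thesis
        using below[OF \<delta>] by blast
    qed
  qed
qed

section \<open>An independent family of subsets obtained from diamond\<close>

lemma Pow_greater: "r <o |Pow (Field r)|"
  using card_of_Field_ordIso[OF Card] card_of_Pow[of "Field r"] ordIso_ordLess_trans ordIso_symmetric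
  by blast

text \<open>This single non-inclusion yields both the properness of the filter and the failure of
  the Galvin property. Regularity enters by placing all the indices used for \<open>J\<close>, and
  points distinguishing its members from \<open>Z\<close>, below one ordinal.\<close>

lemma independent_sets:
  assumes "diamond r"
  obtains A :: "'a set \<Rightarrow> 'a set" where "\<And>Y. A Y \<subseteq> Field r"
    "\<And>C J Z. club r C \<Longrightarrow> J \<subseteq> Pow (Field r) \<Longrightarrow> |J| <o r \<Longrightarrow> Z \<subseteq> Field r \<Longrightarrow> Z \<notin> J \<Longrightarrow>
       \<not> C \<inter> (\<Inter>Y\<in>J. A Y) \<subseteq> A Z"
proof -
  obtain X where
    X: "\<And>Y. Y \<subseteq> Field r \<Longrightarrow> stationary r {\<alpha>\<in>Field r. Y \<inter> underS r \<alpha> = X \<alpha>}"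
    using assms unfolding diamond_def by blast
  obtain \<pi> where \<pi>: "inj_on \<pi> (Field r \<times> Field r)" "\<pi> ` (Field r \<times> Field r) \<subseteq> Field r"
    using card_of_Times_same_infinite[OF infinite_Field, THEN ordIso_imp_ordLeq]
    unfolding card_of_ordLeq[symmetric] by blast
  define p where "p x y = \<pi> (x, y)" for x y
  have p_Field: "p x y \<in> Field r" if "x \<in> Field r" "y \<in> Field r" for x y
    using \<pi>(2) that unfolding p_def by blast
  have p_inj: "x = x' \<and> y = y'"
    if "p x y = p x' y'" "x \<in> Field r" "y \<in> Field r" "x' \<in> Field r" "y' \<in> Field r" for x y x' y'
    using inj_onD[OF \<pi>(1), of "(x, y)" "(x', y')"] that unfolding p_def by simp
  obtain z where z: "z \<in> Field r"
    using infinite_Field infinite_imp_nonempty by blast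
  \<comment> \<open>The section of the guess \<open>X \<alpha>\<close> at index \<open>j\<close>,
    cut off at \<alpha>.\<close>
  define slot where "slot \<alpha> j = {\<beta>\<in>underS r \<alpha>. p j \<beta> \<in> X \<alpha>}" for \<alpha> j
  \<comment> \<open>Indices other than \<open>z\<close> propose sets, while \<open>z\<close> vetoes
    one. The veto removes a value rather than an index, so the vetoed set stays out even if another
    index proposes it.\<close>
  define A where
    "A Y = {\<alpha>\<in>Field r. Y \<inter> underS r \<alpha> \<in> slot \<alpha> ` (underS r \<alpha> - {z}) - {slot \<alpha> z}}" for Y
  have "\<not> C \<inter> (\<Inter>Y\<in>J. A Y) \<subseteq> A Z"
    if C: "club r C" and J: "J \<subseteq> Pow (Field r)" "|J| <o r" and Z: "Z \<subseteq> Field r" "Z \<notin> J" for C J Z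
  proof -
    \<comment> \<open>The members of \<open>J\<close> receive distinct indices \<open>g Y\<close>;
      composing with \<open>h\<close> keeps \<open>z\<close> free for \<open>Z\<close>.\<close>
    have "|J| \<le>o |Field r|"
      using J(2) card_of_Field_ordIso[OF Card] ordIso_symmetric ordLess_imp_ordLeq
        ordLeq_ordIso_trans by blast
    then obtain g0 where g0: "inj_on g0 J" "g0 ` J \<subseteq> Field r"
      unfolding card_of_ordLeq[symmetric] by blast
    obtain h where h: "bij_betw h (Field r) (Field r - {z})"
      using infinite_imp_bij_betw[OF infinite_Field] by blast
    define g where "g = h \<circ> g0"
    have "inj_on h (g0 ` J)"
      using inj_on_subset[OF bij_betw_imp_inj_on[OF h] g0(2)] .
    then have g: "inj_on g J" "g ` J \<subseteq> Field r - {z}"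
      using comp_inj_on[OF g0(1), of h] image_mono[OF g0(2), of h] bij_betw_imp_surj_on[OF h]
      unfolding g_def image_comp[symmetric] by simp_all
    \<comment> \<open>Above \<open>d Y\<close> the traces of \<open>Y\<close> and \<open>Z\<close>
      differ, so the veto against \<open>Z\<close> does not hit \<open>Y\<close>.\<close>
    have "\<forall>Y\<in>J. \<exists>d\<in>Field r. (d \<in> Y) \<noteq> (d \<in> Z)"
      using J(1) Z by (metis PowD subsetD subset_antisym subsetI)
    then obtain d where d: "\<And>Y. Y \<in> J \<Longrightarrow> d Y \<in> Field r \<and> (d Y \<in> Y) \<noteq> (d Y \<in> Z)"
      by metis
    have "{z} \<union> (g ` J \<union> d ` J) \<subseteq> Field r"
      using z g(2) d by blast
    moreover have "|{z} \<union> (g ` J \<union> d ` J)| <o r"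
      using J(2) finite_less[of "{z}"] by (intro Un_less image_less) auto
    ultimately obtain E where E: "club r E" "\<And>\<delta>. \<delta> \<in> E \<Longrightarrow> {z} \<union> (g ` J \<union> d ` J) \<subseteq> underS r \<delta>"
      "\<And>\<delta> x y. \<delta> \<in> E \<Longrightarrow> x \<in> underS r \<delta> \<Longrightarrow> y \<in> underS r \<delta> \<Longrightarrow> p x y \<in> underS r \<delta>"
      using club_above_closed[of _ p] p_Field by blast
    define code where "code = p z ` Z \<union> (\<Union>Y\<in>J. p (g Y) ` Y)"
    have code_sub: "code \<subseteq> Field r"
      using p_Field z Z(1) J(1) g(2) unfolding code_def by blast
    have code_z: "p z \<beta> \<in> code \<longleftrightarrow> \<beta> \<in> Z" if "\<beta> \<in> Field r" for \<beta>
    proof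
      assume "p z \<beta> \<in> code"
      then consider y where "y \<in> Z" "p z \<beta> = p z y"
        | Y y where "Y \<in> J" "y \<in> Y" "p z \<beta> = p (g Y) y"
        unfolding code_def by blast
      then show "\<beta> \<in> Z"
      proof cases
        case 1
        then show ?thesis using p_inj[of z \<beta> z y] z that Z(1) by blast
      next
        case 2
        then have "y \<in> Field r" "g Y \<in> Field r - {z}"
          using J(1) g(2) by blast+
        then show ?thesis using p_inj[of z \<beta> "g Y" y] 2 z that by blast
      qed
    qed (simp add: code_def)
    have code_g: "p (g Y) \<beta> \<in> code \<longleftrightarrow> \<beta> \<in> Y" if Y: "Y \<in> J" and \<beta>: "\<beta> \<in> Field r" for Y \<beta>
    proof
      have gY: "g Y \<in> Field r - {z}"
        using Y g(2) by blast
      assume "p (g Y) \<beta> \<in> code"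
      then consider y where "y \<in> Z" "p (g Y) \<beta> = p z y"
        | Y' y where "Y' \<in> J" "y \<in> Y'" "p (g Y) \<beta> = p (g Y') y"
        unfolding code_def by blast
      then show "\<beta> \<in> Y"
      proof cases
        case 1
        then show ?thesis using p_inj[of "g Y" \<beta> z y] z \<beta> gY Z(1) by blast
      next
        case 2
        then have "y \<in> Field r" "g Y' \<in> Field r"
          using J(1) g(2) by blast+
        then have "g Y = g Y'" "\<beta> = y"
          using p_inj[of "g Y" \<beta> "g Y'" y] 2 gY \<beta> by blast+
        then show ?thesis using inj_onD[OF g(1)] 2 Y by blast
      qed
    qed (use Y in \<open>auto simp: code_def\<close>)
    \<comment> \<open>The guessing set of \<open>code\<close> is stationary, so it meets the club
      \<open>C \<inter> E\<close>.\<close>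
    obtain \<alpha> where \<alpha>: "\<alpha> \<in> Field r" "code \<inter> underS r \<alpha> = X \<alpha>" "\<alpha> \<in> C" "\<alpha> \<in> E"
      using X[OF code_sub] club_Int[OF C E(1)] unfolding stationary_def by blast
    \<comment> \<open>Since \<alpha> is closed under \<open>p\<close>, the pair
      \<open>p j \<beta>\<close> lies below \<alpha>, where \<open>X \<alpha>\<close> agrees with
      \<open>code\<close>.\<close>
    have slot_iff: "\<beta> \<in> slot \<alpha> j \<longleftrightarrow> \<beta> \<in> underS r \<alpha> \<and> p j \<beta> \<in> code" if "j \<in> underS r \<alpha>" for j \<beta>
      using E(3)[OF \<alpha>(4) that] unfolding slot_def \<alpha>(2)[symmetric] by blast
    have slot_z: "slot \<alpha> z = Z \<inter> underS r \<alpha>"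
      using slot_iff[of z] code_z E(2)[OF \<alpha>(4)] underS_in_Field by blast
    have slot_g: "slot \<alpha> (g Y) = Y \<inter> underS r \<alpha>" if "Y \<in> J" for Y
      using slot_iff[of "g Y"] code_g[OF that] E(2)[OF \<alpha>(4)] underS_in_Field that by blast
    have "\<alpha> \<in> A Y" if Y: "Y \<in> J" for Y
    proof -
      have "Y \<inter> underS r \<alpha> \<noteq> Z \<inter> underS r \<alpha>"
        using d[OF Y] E(2)[OF \<alpha>(4)] Y by blast
      moreover have "g Y \<in> underS r \<alpha> - {z}"
        using E(2)[OF \<alpha>(4)] g(2) Y by blast
      ultimately show ?thesis
        using \<alpha>(1) slot_z slot_g[OF Y] unfolding A_def by blast
    qed
    moreover have "\<alpha> \<notin> A Z"
      by (simp add: A_def slot_z)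
    ultimately show ?thesis
      using \<alpha>(3) by blast
  qed
  moreover have "A Y \<subseteq> Field r" for Y
    unfolding A_def by blast
  ultimately show ?thesis
    using that by blast
qed

section \<open>The \<kappa>-complete filter generated by the clubs and a family of sets\<close>

definition generated_filter :: "('b \<Rightarrow> 'a set) \<Rightarrow> 'b set \<Rightarrow> 'a set set" where
  "generated_filter A T =
     {B. B \<subseteq> Field r \<and> (\<exists>C J. club r C \<and> J \<subseteq> T \<and> |J| <o r \<and> C \<inter> (\<Inter>Y\<in>J. A Y) \<subseteq> B)}"

lemma generated_filterI:
  "B \<subseteq> Field r \<Longrightarrow> club r C \<Longrightarrow> J \<subseteq> T \<Longrightarrow> |J| <o r \<Longrightarrow> C \<inter> (\<Inter>Y\<in>J. A Y) \<subseteq> B \<Longrightarrow>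
    B \<in> generated_filter A T"
  unfolding generated_filter_def by blast

text \<open>For \<open>J = {}\<close> the intersection over \<open>J\<close> is the whole type,
  which leaves the condition \<open>C \<subseteq> B\<close>.\<close>

lemma Cub_subset_generated_filter: "Cub r \<subseteq> generated_filter A T"
  using generated_filterI[of _ _ "{}"] finite_less[of "{}"] unfolding Cub_def by auto

lemma generator_in_generated_filter:
  "Y \<in> T \<Longrightarrow> A Y \<subseteq> Field r \<Longrightarrow> A Y \<in> generated_filter A T"
  using generated_filterI[of "A Y" "Field r" "{Y}"] club_Field finite_less[of "{Y}"] by auto

text \<open>Witnesses can be pooled: fewer than \<kappa> clubs meet in a club, and by regularity a
  union of fewer than \<kappa> families \<open>J B\<close>, each smaller than \<kappa>, is again
  smaller than \<kappa>.\<close>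

lemma card_complete_generated_filter: "card_complete r (generated_filter A T)"
  unfolding card_complete_def
proof (intro allI impI)
  fix G assume G: "G \<subseteq> generated_filter A T \<and> G \<noteq> {} \<and> |G| <o r"
  then have "\<forall>B\<in>G. \<exists>C J. club r C \<and> J \<subseteq> T \<and> |J| <o r \<and> C \<inter> (\<Inter>Y\<in>J. A Y) \<subseteq> B"
    unfolding generated_filter_def by blast
  then obtain C J where CJ: "\<And>B. B \<in> G \<Longrightarrow>
      club r (C B) \<and> J B \<subseteq> T \<and> |J B| <o r \<and> C B \<inter> (\<Inter>Y\<in>J B. A Y) \<subseteq> B"
    by metis
  show "\<Inter>G \<in> generated_filter A T"
  proof (rule generated_filterI)
    show "\<Inter>G \<subseteq> Field r"
      using G unfolding generated_filter_def by blast
    show "club r (\<Inter>B\<in>G. C B)"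
      using club_Inter G CJ by blast
    show "|\<Union>B\<in>G. J B| <o r"
      using UN_less G CJ by blast
    show "(\<Union>B\<in>G. J B) \<subseteq> T"
      using CJ by blast
    show "(\<Inter>B\<in>G. C B) \<inter> (\<Inter>Y\<in>(\<Union>B\<in>G. J B). A Y) \<subseteq> \<Inter>G"
    proof (rule Inter_greatest)
      fix B assume B: "B \<in> G"
      then have "(\<Inter>B\<in>G. C B) \<inter> (\<Inter>Y\<in>(\<Union>B\<in>G. J B). A Y) \<subseteq> C B \<inter> (\<Inter>Y\<in>J B. A Y)"
        by auto
      also have "\<dots> \<subseteq> B"
        using CJ[OF B] by simp
      finally show "(\<Inter>B\<in>G. C B) \<inter> (\<Inter>Y\<in>(\<Union>B\<in>G. J B). A Y) \<subseteq> B" .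
    qed
  qed
qed

lemma filter_over_generated_filter:
  assumes "\<And>C J. club r C \<Longrightarrow> J \<subseteq> T \<Longrightarrow> |J| <o r \<Longrightarrow> C \<inter> (\<Inter>Y\<in>J. A Y) \<noteq> {}"
  shows "filter_over (Field r) (generated_filter A T)"
proof -
  have "Field r \<in> generated_filter A T"
    using Cub_subset_generated_filter club_Field unfolding Cub_def by blast
  \<comment> \<open>Binary intersections are the case of a two-element family in
    completeness.\<close>
  moreover have "B \<inter> B' \<in> generated_filter A T"
    if "B \<in> generated_filter A T" "B' \<in> generated_filter A T" for B B'
    using card_complete_generated_filter[of A T, unfolded card_complete_def, rule_format, of "{B, B'}"]
      that finite_less[of "{B, B'}"] by auto
  moreover have "{} \<notin> generated_filter A T"
    using assms unfolding generated_filter_def by blast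
  moreover have "B' \<in> generated_filter A T"
    if "B \<in> generated_filter A T" "B \<subseteq> B'" "B' \<subseteq> Field r" for B B'
    using that unfolding generated_filter_def by blast
  moreover have "generated_filter A T \<subseteq> Pow (Field r)"
    unfolding generated_filter_def by blast
  ultimately show ?thesis
    unfolding filter_over_def by simp
qed

end

section \<open>Failure of the Galvin property\<close>

theorem theorem5p5:
  fixes r :: "'a rel"
  assumes "Card_order r"
    and "natLeq <o r"
    and "regularCard r"
    and "diamond r"
  shows "\<exists>F :: 'a set set.
           filter_over (Field r) F \<and> card_complete r F \<and> Cub r \<subseteq> F \<and>
           (\<exists>A :: 'a set \<Rightarrow> 'a set.
              (\<forall>i\<in>Field (cardSuc r). A i \<in> F) \<and>
              (\<forall>I. I \<subseteq> Field (cardSuc r) \<and> |I| =o r \<longrightarrow> (\<Inter>i\<in>I. A i) \<notin> F))"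
proof -
  interpret uncountable_regular_card r
    using assms by unfold_locales
  obtain A :: "'a set \<Rightarrow> 'a set" where A: "\<And>Y. A Y \<subseteq> Field r"
    and indep: "\<And>C J Z. club r C \<Longrightarrow> J \<subseteq> Pow (Field r) \<Longrightarrow> |J| <o r \<Longrightarrow> Z \<subseteq> Field r \<Longrightarrow> Z \<notin> J \<Longrightarrow>
       \<not> C \<inter> (\<Inter>Y\<in>J. A Y) \<subseteq> A Z"
    by (fact independent_sets[OF assms(4)])
  let ?F = "generated_filter A (Pow (Field r))"
  have "filter_over (Field r) ?F"
  proof (rule filter_over_generated_filter)
    fix C J assume CJ: "club r C" "J \<subseteq> Pow (Field r)" "|J| <o r"
    \<comment> \<open>Cardinality leaves some \<open>Z\<close> outside \<open>J\<close>. An empty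
      intersection would be contained in \<open>A Z\<close>, against independence.\<close>
    have "J \<noteq> Pow (Field r)"
      using CJ(3) Pow_greater ordLess_transitive ordLess_irreflexive by blast
    then obtain Z where "Z \<subseteq> Field r" "Z \<notin> J"
      using CJ(2) by blast
    then show "C \<inter> (\<Inter>Y\<in>J. A Y) \<noteq> {}"
      using indep[OF CJ] by blast
  qed
  \<comment> \<open>By Cantor's theorem 2^\<kappa> is at least \<kappa>^+, so \<open>e\<close> picks
    \<kappa>^+ distinct subsets of \<kappa> as indices of the sequence.\<close>
  moreover have "|Field (cardSuc r)| \<le>o |Pow (Field r)|"
    using cardSuc_least[OF Card card_of_Card_order Pow_greater]
      card_of_Field_ordIso[OF cardSuc_Card_order[OF Card]] ordIso_ordLeq_trans by blast
  then obtain e where e: "inj_on e (Field (cardSuc r))" "e ` Field (cardSuc r) \<subseteq> Pow (Field r)"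
    unfolding card_of_ordLeq[symmetric] by blast
  have "A (e i) \<in> ?F" if "i \<in> Field (cardSuc r)" for i
    using generator_in_generated_filter[of "e i" _ A] A e(2) that by blast
  moreover have "(\<Inter>i\<in>I. A (e i)) \<notin> ?F" if I: "I \<subseteq> Field (cardSuc r)" "|I| =o r" for I
  proof
    assume "(\<Inter>i\<in>I. A (e i)) \<in> ?F"
    then obtain C J where CJ: "club r C" "J \<subseteq> Pow (Field r)" "|J| <o r"
      and sub: "C \<inter> (\<Inter>Y\<in>J. A Y) \<subseteq> (\<Inter>i\<in>I. A (e i))"
      unfolding generated_filter_def by blast
    \<comment> \<open>As \<open>e\<close> is injective, the image of \<open>I\<close> has \<kappa>
      elements, too many for \<open>J\<close>. An index left out of \<open>J\<close> contradicts
      independence.\<close>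
    have "\<not> e ` I \<subseteq> J"
    proof
      assume "e ` I \<subseteq> J"
      then have "|I| \<le>o |J|"
        using inj_on_subset[OF e(1) I(1)] card_of_ordLeq by blast
      then have "|I| <o r"
        using CJ(3) ordLeq_ordLess_trans by blast
      then show False
        using I(2) not_ordLess_ordIso by blast
    qed
    then obtain i where "i \<in> I" "e i \<notin> J"
      by blast
    then have "\<not> C \<inter> (\<Inter>Y\<in>J. A Y) \<subseteq> A (e i)"
      using e(2) I(1) by (intro indep[OF CJ]) auto
    moreover have "C \<inter> (\<Inter>Y\<in>J. A Y) \<subseteq> A (e i)"
      using sub INT_lower[OF \<open>i \<in> I\<close>, of "\<lambda>i. A (e i)"] by (rule order_trans)
    ultimately show False ..
  qed
  ultimately show ?thesis
    by (intro exI[of _ ?F] conjI exI[of _ "\<lambda>i. A (e i)"])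
      (simp_all add: card_complete_generated_filter Cub_subset_generated_filter)
qed

end
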